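(* Let $K\subset\mathbb{R}^2$ be a compact convex set of area $F$ with boundary of class $\mathcal{C}^2$, having the origin as an interior point. Then $$2\int_{G_i\cap K\neq\emptyset}|\sin(\varphi_2-\varphi_1)|\,dG_1\,dG_2=\pi^2F+\int_{P\notin K}(\omega^2-\sin^2\omega)\,dP.$$
   Context: For $P\notin K$, $\omega=\omega(P)\in(0,\pi)$ is the visual angle of $K$ from $P$, i.e. the angle between the two tangents from $P$ to the boundary of $K$ (the angle at $P$ of the sector with vertex $P$ containing $K$), and $dP$ is the area element of the plane. A line $G\subset\mathbb{R}^2$ not passing through the origin is given coordinates $(p,\varphi)$, $p>0$, $0\le\varphi<2\pi$, which are the polar coordinates of the point of $G$ at minimum distance from the origin (lines through the origin form a null set and are disregarded). $dG=dp\,d\varphi$, and ordered pairs of lines $(G_1,G_2)$, with coordinates $(p_i,\varphi_i)$, carry the measure $dG_1\,dG_2=dp_1\,d\varphi_1\,dp_2\,d\varphi_2$. The integral over $G_i\cap K\neq\emptyset$ is over all ordered pairs $(G_1,G_2)$ such that both $G_1$ and $G_2$ meet $K$. *)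

theory Defs
  imports "HOL-Analysis.Analysis"
begin

type_synonym plane = "real \<times> real"

definition direction :: "real \<Rightarrow> plane" where
  "direction \<theta> = (cos \<theta>, sin \<theta>)"

text \<open>A regular simple closed curve of class C2. Periodicity on the whole real line makes
  the derivatives match at the closing point as well.\<close>

definition C2_closed_curve :: "(real \<Rightarrow> plane) \<Rightarrow> bool" where
  "C2_closed_curve \<gamma> \<longleftrightarrow>
     (\<exists>\<gamma>' \<gamma>''.
        (\<forall>t. (\<gamma> has_vector_derivative \<gamma>' t) (at t)) \<and>
        (\<forall>t. (\<gamma>' has_vector_derivative \<gamma>'' t) (at t)) \<and>
        continuous_on UNIV \<gamma>'' \<and>
        (\<forall>t. \<gamma>' t \<noteq> 0)) \<and>
     (\<forall>t. \<gamma> (t + 1) = \<gamma> t) \<and>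
     inj_on \<gamma> {0..<1}"

definition C2_boundary :: "plane set \<Rightarrow> bool" where
  "C2_boundary K \<longleftrightarrow> (\<exists>\<gamma>. C2_closed_curve \<gamma> \<and> frontier K = range \<gamma>)"

text \<open>The line with coordinates \<open>(p, \<phi>)\<close> passes through the point with these polar
  coordinates and is orthogonal to its position vector; by the lemma below this point is the
  one closest to the origin.\<close>

definition line :: "real \<Rightarrow> real \<Rightarrow> plane set" where
  "line p \<phi> = {x. (x - p *\<^sub>R direction \<phi>) \<bullet> direction \<phi> = 0}"

lemma closest_point_line: "closest_point (line p \<phi>) 0 = p *\<^sub>R direction \<phi>"
proof -
  let ?u = "direction \<phi>"
  have u: "?u \<bullet> ?u = 1" "norm ?u = 1"
    by (simp_all add: direction_def inner_prod_def norm_prod_def flip: power2_eq_square)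
  have L: "line p \<phi> = {x. ?u \<bullet> x = p}"
    unfolding line_def inner_diff_left inner_scaleR_left u by (simp add: inner_commute)
  have le: "\<bar>p\<bar> \<le> norm x" if "x \<in> line p \<phi>" for x
    using that Cauchy_Schwarz_ineq2[of ?u x] u by (simp add: L)
  show ?thesis
  proof (rule closest_point_unique[symmetric])
    show "convex (line p \<phi>)" "closed (line p \<phi>)"
      unfolding L by (rule convex_hyperplane closed_hyperplane)+
  qed (use u le in \<open>simp_all add: line_def\<close>)
qed

definition lines_meeting :: "plane set \<Rightarrow> (real \<times> real) set" where
  "lines_meeting K = {(p, \<phi>). 0 < p \<and> 0 \<le> \<phi> \<and> \<phi> < 2 * pi \<and> line p \<phi> \<inter> K \<noteq> {}}"

definition ray :: "plane \<Rightarrow> real \<Rightarrow> plane set" where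
  "ray P \<theta> = {P + r *\<^sub>R direction \<theta> | r. 0 \<le> r}"

definition sector :: "plane \<Rightarrow> real \<Rightarrow> real \<Rightarrow> plane set" where
  "sector P \<alpha> \<omega> = (\<Union>\<theta>\<in>{\<alpha>..\<alpha> + \<omega>}. ray P \<theta>)"

text \<open>A sector with vertex \<open>P\<close> contains \<open>K\<close> and both of its bounding rays touch \<open>K\<close>, so
  that these rays lie on the two tangents from \<open>P\<close>. For compact convex \<open>K\<close> with interior
  points and \<open>P \<notin> K\<close> there is exactly one such angle.\<close>

definition visual_angle :: "plane set \<Rightarrow> plane \<Rightarrow> real" where
  "visual_angle K P =
     (THE \<omega>. 0 < \<omega> \<and> \<omega> < pi \<and>
        (\<exists>\<alpha>. K \<subseteq> sector P \<alpha> \<omega> \<and> ray P \<alpha> \<inter> K \<noteq> {} \<and> ray P (\<alpha> + \<omega>) \<inter> K \<noteq> {}))"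

end

theory Submission
  imports Defs
begin

text \<open>
  Two non-parallel lines are determined by their intersection point \<open>P\<close> and their normal angles
  \<open>\<phi>\<close> and \<open>\<psi>\<close>, and in these coordinates \<open>dp dq = \<bar>sin (\<psi> - \<phi>)\<bar> dP\<close>
  (\<open>nn_integral_line_pairs_by_intersection\<close>). So the integral over pairs of lines equals the integral over the
  plane of the density
  \<open>\<integral>\<integral> sin\<^sup>2 (\<psi> - \<phi>) d\<phi> d\<psi>\<close>, taken over pairs of lines through \<open>P\<close> that meet \<open>K\<close>.

  This integrand has period \<open>\<pi>\<close> in each angle, and the angular coordinate of a line not through
  the origin is one of its two opposite normal angles, so the angles may be taken from any interval of length \<open>\<pi>\<close>
  (\<open>nn_integral_half_circle\<close>). If \<open>P\<close> lies in \<open>K\<close>, all lines through \<open>P\<close> meet \<open>K\<close>. Otherwise the normal angles of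
  the lines that do form, modulo \<open>\<pi>\<close>, an interval whose length is the visual angle \<open>\<omega>\<close>
  (\<open>normals_of_spanned_angle\<close>). The density is \<open>(\<omega>\<^sup>2 - sin\<^sup>2 \<omega>) / 2\<close> by
  \<open>nn_integral_sin_squared_square\<close>, with \<open>\<omega> = \<pi>\<close> for \<open>P\<close> in \<open>K\<close>, where it amounts to the constant
  \<open>\<pi>\<^sup>2 / 2\<close>. Integrating over \<open>K\<close> and its complement and doubling gives the formula.

  Working with nonnegative integrals in the extended reals makes all changes in the order of
  integration legitimate; integrability is then read off from the finiteness of the integral over
  pairs of lines.
\<close>

section \<open>Pairs of lines and their intersection points\<close>

lemma nn_integral_lborel_pair_iterated:
  fixes f :: "'a::euclidean_space \<times> 'b::euclidean_space \<Rightarrow> ennreal"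
  assumes [measurable]: "f \<in> borel_measurable borel"
  shows "(\<integral>\<^sup>+z. f z \<partial>lborel) = (\<integral>\<^sup>+x. \<integral>\<^sup>+y. f (x, y) \<partial>lborel \<partial>lborel)"
proof -
  have "(\<integral>\<^sup>+z. f z \<partial>lborel) = (\<integral>\<^sup>+z. f z \<partial>(lborel \<Otimes>\<^sub>M lborel))"
    by (simp add: lborel_prod)
  also have "\<dots> = (\<integral>\<^sup>+x. \<integral>\<^sup>+y. f (x, y) \<partial>lborel \<partial>lborel)"
    by (rule lborel.nn_integral_fst[symmetric]) (simp add: lborel_prod)
  finally show ?thesis .
qed

lemma nn_integral_lborel_swap:
  fixes f :: "'a::euclidean_space \<Rightarrow> 'b::euclidean_space \<Rightarrow> ennreal"
  assumes "(\<lambda>(x, y). f x y) \<in> borel_measurable borel"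
  shows "(\<integral>\<^sup>+x. \<integral>\<^sup>+y. f x y \<partial>lborel \<partial>lborel) = (\<integral>\<^sup>+y. \<integral>\<^sup>+x. f x y \<partial>lborel \<partial>lborel)"
  using assms by (intro lborel_pair.Fubini'[symmetric]) (simp add: lborel_prod)

text \<open>Elimination, one coordinate at a time: the matrix is the product of the triangular maps
  \<open>(p, y) \<mapsto> (p, c / a * p + D / a * y)\<close>, with \<open>D\<close> the determinant, and
  \<open>(x, y) \<mapsto> (a * x + b * y, y)\<close>. Each of them is an affine substitution in one real variable, and
  the two scaling factors \<open>\<bar>D / a\<bar>\<close> and \<open>\<bar>a\<bar>\<close> multiply to \<open>\<bar>D\<bar>\<close>.\<close>

lemma nn_integral_lborel_linear_substitution_aux:
  fixes g :: "real \<times> real \<Rightarrow> ennreal"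
  assumes [measurable]: "g \<in> borel_measurable borel"
    and det: "a * d - b * c \<noteq> 0" and a: "a \<noteq> 0"
  shows "(\<integral>\<^sup>+z. g z \<partial>lborel)
    = ennreal \<bar>a * d - b * c\<bar> * (\<integral>\<^sup>+(x, y). g (a * x + b * y, c * x + d * y) \<partial>lborel)"
proof -
  let ?D = "a * d - b * c"
  have "(\<integral>\<^sup>+z. g z \<partial>lborel) = (\<integral>\<^sup>+p. \<integral>\<^sup>+q. g (p, q) \<partial>lborel \<partial>lborel)"
    by (simp add: nn_integral_lborel_pair_iterated)
  also have "\<dots> = (\<integral>\<^sup>+p. \<bar>?D / a\<bar> * (\<integral>\<^sup>+y. g (p, c / a * p + ?D / a * y) \<partial>lborel) \<partial>lborel)"
    using det a by (intro nn_integral_cong nn_integral_real_affine) auto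
  also have "\<dots> = \<bar>?D / a\<bar> * (\<integral>\<^sup>+p. \<integral>\<^sup>+y. g (p, c / a * p + ?D / a * y) \<partial>lborel \<partial>lborel)"
    by (intro nn_integral_cmult) measurable
  also have "(\<integral>\<^sup>+p. \<integral>\<^sup>+y. g (p, c / a * p + ?D / a * y) \<partial>lborel \<partial>lborel)
    = (\<integral>\<^sup>+y. \<integral>\<^sup>+p. g (p, c / a * p + ?D / a * y) \<partial>lborel \<partial>lborel)"
    by (intro nn_integral_lborel_swap) (simp add: borel_prod[symmetric])
  also have "\<dots> = (\<integral>\<^sup>+y. \<bar>a\<bar> * (\<integral>\<^sup>+x. g (b * y + a * x, c / a * (b * y + a * x) + ?D / a * y) \<partial>lborel) \<partial>lborel)"
    using a by (intro nn_integral_cong nn_integral_real_affine) auto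
  also have "\<dots> = \<bar>a\<bar> * (\<integral>\<^sup>+y. \<integral>\<^sup>+x. g (b * y + a * x, c / a * (b * y + a * x) + ?D / a * y) \<partial>lborel \<partial>lborel)"
    by (intro nn_integral_cmult) measurable
  also have "(\<lambda>y x. g (b * y + a * x, c / a * (b * y + a * x) + ?D / a * y))
    = (\<lambda>y x. g (a * x + b * y, c * x + d * y))"
  proof (intro ext)
    fix y x
    have "c / a * (b * y + a * x) + ?D / a * y = c * x + d * y"
      using a by (simp add: divide_simps) (simp add: algebra_simps)
    then show "g (b * y + a * x, c / a * (b * y + a * x) + ?D / a * y) = g (a * x + b * y, c * x + d * y)"
      by (simp add: add.commute)
  qed
  also have "(\<integral>\<^sup>+y. \<integral>\<^sup>+x. g (a * x + b * y, c * x + d * y) \<partial>lborel \<partial>lborel)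
    = (\<integral>\<^sup>+(x, y). g (a * x + b * y, c * x + d * y) \<partial>lborel)"
    by (subst nn_integral_lborel_swap)
      (simp_all add: nn_integral_lborel_pair_iterated borel_prod[symmetric])
  finally show ?thesis
    using a by (simp add: mult.assoc[symmetric] ennreal_mult[symmetric] abs_mult)
qed

text \<open>When the pivot \<open>a\<close> vanishes, the determinant forces \<open>c \<noteq> 0\<close>, so interchanging the two
  output coordinates leads back to elimination with a nonzero pivot.\<close>

lemma nn_integral_lborel_linear_substitution:
  fixes g :: "real \<times> real \<Rightarrow> ennreal"
  assumes [measurable]: "g \<in> borel_measurable borel"
    and det: "a * d - b * c \<noteq> 0"
  shows "(\<integral>\<^sup>+z. g z \<partial>lborel)
    = ennreal \<bar>a * d - b * c\<bar> * (\<integral>\<^sup>+(x, y). g (a * x + b * y, c * x + d * y) \<partial>lborel)"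
proof (cases "a = 0")
  case False
  then show ?thesis using assms by (intro nn_integral_lborel_linear_substitution_aux)
next
  case True
  have [measurable]: "(\<lambda>(q, p). g (p, q)) \<in> borel_measurable borel"
    by (simp add: borel_prod[symmetric])
  have "(\<integral>\<^sup>+z. g z \<partial>lborel) = (\<integral>\<^sup>+(q, p). g (p, q) \<partial>lborel)"
    by (simp add: nn_integral_lborel_pair_iterated, rule nn_integral_lborel_swap, simp)
  also have "\<dots> = ennreal \<bar>c * b - d * a\<bar> * (\<integral>\<^sup>+(x, y). g (a * x + b * y, c * x + d * y) \<partial>lborel)"
    using True det nn_integral_lborel_linear_substitution_aux[of "\<lambda>(q, p). g (p, q)" c b d a]
    by auto
  finally show ?thesis
    by (simp add: abs_minus_commute mult.commute)
qed

lemma inner_direction_coords: "P \<bullet> direction \<phi> = cos \<phi> * fst P + sin \<phi> * snd P"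
  by (simp add: direction_def inner_prod_def mult.commute)

lemma continuous_direction [continuous_intros]:
  fixes f :: "'a::t2_space \<Rightarrow> real"
  shows "continuous_on S f \<Longrightarrow> continuous_on S (\<lambda>x. direction (f x))"
  unfolding direction_def by (intro continuous_intros)

lemma measurable_direction [measurable]: "direction \<in> borel_measurable borel"
  by (intro borel_measurable_continuous_onI continuous_intros)

text \<open>Lines with normal angles \<open>\<phi>\<close> and \<open>\<psi>\<close> that meet in \<open>P\<close> have the signed distances
  \<open>P \<bullet> direction \<phi>\<close> and \<open>P \<bullet> direction \<psi>\<close> from the origin. For fixed angles this is a linear map
  of \<open>P\<close> with determinant \<open>sin (\<psi> - \<phi>)\<close>, which is the classical
  \<open>dp dq = \<bar>sin (\<psi> - \<phi>)\<bar> dP\<close>. Parallel pairs contribute nothing to either side, because the weight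
  vanishes on them, so that no exceptional set has to be removed.\<close>

lemma nn_integral_line_pairs_by_intersection:
  fixes f :: "(real \<times> real) \<times> (real \<times> real) \<Rightarrow> ennreal"
  assumes "f \<in> borel_measurable borel"
  shows "(\<integral>\<^sup>+((p, \<phi>), (q, \<psi>)). ennreal \<bar>sin (\<psi> - \<phi>)\<bar> * f ((p, \<phi>), (q, \<psi>)) \<partial>lborel)
    = (\<integral>\<^sup>+P. \<integral>\<^sup>+\<phi>. \<integral>\<^sup>+\<psi>. ennreal ((sin (\<psi> - \<phi>))\<^sup>2)
          * f ((P \<bullet> direction \<phi>, \<phi>), (P \<bullet> direction \<psi>, \<psi>)) \<partial>lborel \<partial>lborel \<partial>lborel)"
proof -
  have f[measurable]: "f \<in> borel_measurable ((borel \<Otimes>\<^sub>M borel) \<Otimes>\<^sub>M (borel \<Otimes>\<^sub>M borel))"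
    using assms by (simp add: borel_prod)
  let ?h = "\<lambda>p \<phi> q \<psi>. ennreal \<bar>sin (\<psi> - \<phi>)\<bar> * f ((p, \<phi>), (q, \<psi>))"
  have subst: "(\<integral>\<^sup>+p. \<integral>\<^sup>+q. ?h p \<phi> q \<psi> \<partial>lborel \<partial>lborel)
    = (\<integral>\<^sup>+P. ennreal ((sin (\<psi> - \<phi>))\<^sup>2)
          * f ((P \<bullet> direction \<phi>, \<phi>), (P \<bullet> direction \<psi>, \<psi>)) \<partial>lborel)" for \<phi> \<psi>
  proof (cases "sin (\<psi> - \<phi>) = 0")
    case True
    then show ?thesis by simp
  next
    case False
    have det: "cos \<phi> * sin \<psi> - sin \<phi> * cos \<psi> = sin (\<psi> - \<phi>)"
      by (simp add: sin_diff mult.commute)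
    have [measurable]: "(\<lambda>(p, q). f ((p, \<phi>), (q, \<psi>))) \<in> borel_measurable borel"
      by (simp add: borel_prod[symmetric])
    have [measurable]: "(\<lambda>P. f ((P \<bullet> direction \<phi>, \<phi>), (P \<bullet> direction \<psi>, \<psi>))) \<in> borel_measurable borel"
      by measurable
    have "(\<integral>\<^sup>+p. \<integral>\<^sup>+q. ?h p \<phi> q \<psi> \<partial>lborel \<partial>lborel)
      = ennreal \<bar>sin (\<psi> - \<phi>)\<bar> * (\<integral>\<^sup>+p. \<integral>\<^sup>+q. f ((p, \<phi>), (q, \<psi>)) \<partial>lborel \<partial>lborel)"
      by (simp add: nn_integral_cmult)
    also have "(\<integral>\<^sup>+p. \<integral>\<^sup>+q. f ((p, \<phi>), (q, \<psi>)) \<partial>lborel \<partial>lborel)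
      = (\<integral>\<^sup>+(p, q). f ((p, \<phi>), (q, \<psi>)) \<partial>lborel)"
      by (simp add: nn_integral_lborel_pair_iterated)
    also have "\<dots> = ennreal \<bar>sin (\<psi> - \<phi>)\<bar>
        * (\<integral>\<^sup>+P. f ((P \<bullet> direction \<phi>, \<phi>), (P \<bullet> direction \<psi>, \<psi>)) \<partial>lborel)"
      using False nn_integral_lborel_linear_substitution[of "\<lambda>(p, q). f ((p, \<phi>), (q, \<psi>))"
          "cos \<phi>" "sin \<psi>" "sin \<phi>" "cos \<psi>"]
      by (simp add: det inner_direction_coords split_beta' borel_prod[symmetric])
    finally show ?thesis
      by (simp add: nn_integral_cmult mult.assoc[symmetric] ennreal_mult[symmetric]
          power2_eq_square)
  qed
  have "(\<integral>\<^sup>+((p, \<phi>), (q, \<psi>)). ?h p \<phi> q \<psi> \<partial>lborel)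
    = (\<integral>\<^sup>+z. \<integral>\<^sup>+w. ?h (fst z) (snd z) (fst w) (snd w) \<partial>lborel \<partial>lborel)"
    by (subst nn_integral_lborel_pair_iterated) (simp_all add: split_beta' borel_prod[symmetric])
  also have "\<dots> = (\<integral>\<^sup>+p. \<integral>\<^sup>+\<phi>. \<integral>\<^sup>+q. \<integral>\<^sup>+\<psi>. ?h p \<phi> q \<psi> \<partial>lborel \<partial>lborel \<partial>lborel \<partial>lborel)"
    by (subst nn_integral_lborel_pair_iterated,
        simp add: lborel_prod[symmetric] borel_prod[symmetric], measurable)
      (subst nn_integral_lborel_pair_iterated,
        simp_all add: lborel_prod[symmetric] borel_prod[symmetric])
  also have "\<dots> = (\<integral>\<^sup>+\<phi>. \<integral>\<^sup>+p. \<integral>\<^sup>+q. \<integral>\<^sup>+\<psi>. ?h p \<phi> q \<psi> \<partial>lborel \<partial>lborel \<partial>lborel \<partial>lborel)"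
    by (intro nn_integral_lborel_swap) (simp add: borel_prod[symmetric])
  also have "\<dots> = (\<integral>\<^sup>+\<phi>. \<integral>\<^sup>+p. \<integral>\<^sup>+\<psi>. \<integral>\<^sup>+q. ?h p \<phi> q \<psi> \<partial>lborel \<partial>lborel \<partial>lborel \<partial>lborel)"
    by (intro nn_integral_cong nn_integral_lborel_swap) (simp add: borel_prod[symmetric])
  also have "\<dots> = (\<integral>\<^sup>+\<phi>. \<integral>\<^sup>+\<psi>. \<integral>\<^sup>+p. \<integral>\<^sup>+q. ?h p \<phi> q \<psi> \<partial>lborel \<partial>lborel \<partial>lborel \<partial>lborel)"
    by (intro nn_integral_cong nn_integral_lborel_swap) (simp add: borel_prod[symmetric])
  also have "\<dots> = (\<integral>\<^sup>+\<phi>. \<integral>\<^sup>+\<psi>. \<integral>\<^sup>+P. ennreal ((sin (\<psi> - \<phi>))\<^sup>2)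
          * f ((P \<bullet> direction \<phi>, \<phi>), (P \<bullet> direction \<psi>, \<psi>)) \<partial>lborel \<partial>lborel \<partial>lborel)"
    by (simp only: subst)
  also have "\<dots> = (\<integral>\<^sup>+\<phi>. \<integral>\<^sup>+P. \<integral>\<^sup>+\<psi>. ennreal ((sin (\<psi> - \<phi>))\<^sup>2)
          * f ((P \<bullet> direction \<phi>, \<phi>), (P \<bullet> direction \<psi>, \<psi>)) \<partial>lborel \<partial>lborel \<partial>lborel)"
    by (intro nn_integral_cong nn_integral_lborel_swap) (simp add: borel_prod[symmetric] inner_direction_coords)
  also have "\<dots> = (\<integral>\<^sup>+P. \<integral>\<^sup>+\<phi>. \<integral>\<^sup>+\<psi>. ennreal ((sin (\<psi> - \<phi>))\<^sup>2)
          * f ((P \<bullet> direction \<phi>, \<phi>), (P \<bullet> direction \<psi>, \<psi>)) \<partial>lborel \<partial>lborel \<partial>lborel)"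
    by (intro nn_integral_lborel_swap) (simp add: borel_prod[symmetric] inner_direction_coords)
  finally show ?thesis .
qed

section \<open>Integrals of periodic functions\<close>

lemma nn_integral_lborel_shift:
  fixes f :: "real \<Rightarrow> ennreal"
  assumes "f \<in> borel_measurable borel"
  shows "(\<integral>\<^sup>+x. f (x + t) \<partial>lborel) = (\<integral>\<^sup>+x. f x \<partial>lborel)"
  using nn_integral_real_affine[OF assms, of 1 t] by (simp add: add.commute)

lemma nn_integral_split_interval:
  fixes f :: "real \<Rightarrow> ennreal"
  assumes [measurable]: "f \<in> borel_measurable borel" and "a \<le> b" "b \<le> c"
  shows "(\<integral>\<^sup>+x\<in>{a..<c}. f x \<partial>lborel)
    = (\<integral>\<^sup>+x\<in>{a..<b}. f x \<partial>lborel) + (\<integral>\<^sup>+x\<in>{b..<c}. f x \<partial>lborel)"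
  using assms(2,3) by (subst nn_integral_add[symmetric])
    (auto intro!: nn_integral_cong split: split_indicator)

lemma nn_integral_shift_interval:
  fixes f :: "real \<Rightarrow> ennreal"
  assumes [measurable]: "f \<in> borel_measurable borel"
  shows "(\<integral>\<^sup>+x\<in>{a + t..<b + t}. f x \<partial>lborel) = (\<integral>\<^sup>+x\<in>{a..<b}. f (x + t) \<partial>lborel)"
  by (subst nn_integral_lborel_shift[of _ t, symmetric])
    (auto intro!: nn_integral_cong split: split_indicator)

text \<open>Moving the window by less than one period cuts off a piece on the left and adds its translate
  on the right. Whole periods are taken care of by a translation.\<close>

lemma nn_integral_over_period:
  fixes f :: "real \<Rightarrow> ennreal"
  assumes [measurable]: "f \<in> borel_measurable borel"
    and per: "\<And>x. f (x + T) = f x" and T: "0 < T"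
  shows "(\<integral>\<^sup>+x\<in>{a..<a + T}. f x \<partial>lborel) = (\<integral>\<^sup>+x\<in>{b..<b + T}. f x \<partial>lborel)"
proof -
  interpret periodic_fun_simple f T by standard (rule per)
  have step: "(\<integral>\<^sup>+x\<in>{a..<a + T}. f x \<partial>lborel) = (\<integral>\<^sup>+x\<in>{b..<b + T}. f x \<partial>lborel)"
    if "a \<le> b" "b < a + T" for a b
  proof -
    have "(\<integral>\<^sup>+x\<in>{a..<a + T}. f x \<partial>lborel)
        = (\<integral>\<^sup>+x\<in>{a..<b}. f x \<partial>lborel) + (\<integral>\<^sup>+x\<in>{b..<a + T}. f x \<partial>lborel)"
      using that by (intro nn_integral_split_interval) auto
    also have "(\<integral>\<^sup>+x\<in>{a..<b}. f x \<partial>lborel) = (\<integral>\<^sup>+x\<in>{a + T..<b + T}. f x \<partial>lborel)"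
      by (subst nn_integral_shift_interval) (simp_all only: per assms(1))
    also have "(\<integral>\<^sup>+x\<in>{a + T..<b + T}. f x \<partial>lborel) + (\<integral>\<^sup>+x\<in>{b..<a + T}. f x \<partial>lborel)
        = (\<integral>\<^sup>+x\<in>{b..<b + T}. f x \<partial>lborel)"
      using that nn_integral_split_interval[of f b "a + T" "b + T"]
      by (simp add: add.commute)
    finally show ?thesis .
  qed
  define k where "k = \<lfloor>(b - a) / T\<rfloor>"
  have "of_int k \<le> (b - a) / T" "(b - a) / T < of_int k + 1"
    by (simp_all add: k_def)
  then have k: "a + of_int k * T \<le> b" "b < a + of_int k * T + T"
    using T by (simp_all add: field_simps)
  have "(\<integral>\<^sup>+x\<in>{a..<a + T}. f x \<partial>lborel)
      = (\<integral>\<^sup>+x\<in>{a + of_int k * T..<a + T + of_int k * T}. f x \<partial>lborel)"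
    by (subst nn_integral_shift_interval) (simp_all only: plus_of_int assms(1))
  also have "\<dots> = (\<integral>\<^sup>+x\<in>{b..<b + T}. f x \<partial>lborel)"
    using step[OF k] by (simp add: ac_simps)
  finally show ?thesis .
qed

section \<open>Normal angles modulo a half turn\<close>

lemma direction_shift_pi: "direction (\<phi> + pi) = - direction \<phi>"
  by (simp add: direction_def)

lemma inner_direction_direction: "direction \<alpha> \<bullet> direction \<beta> = cos (\<alpha> - \<beta>)"
  by (simp add: direction_def inner_prod_def cos_diff)

lemma unit_vector_direction:
  fixes e :: plane
  assumes "norm e = 1"
  obtains \<theta> where "e = direction \<theta>"
proof -
  have "(fst e)\<^sup>2 + (snd e)\<^sup>2 = 1"
    using assms by (simp add: norm_prod_def)
  then show ?thesis
    using sincos_total_2pi that by (metis direction_def prod.collapse)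
qed

text \<open>Two zeros in a half-open interval of length \<open>\<pi>\<close> would be two linearly independent directions
  orthogonal to \<open>P\<close>.\<close>

lemma finite_normals_through:
  assumes "P \<noteq> 0"
  shows "finite {\<phi>\<in>{0..<pi}. P \<bullet> direction \<phi> = 0}"
proof -
  have "\<phi> = \<psi>" if "0 \<le> \<phi>" "\<phi> \<le> \<psi>" "\<psi> < pi" "P \<bullet> direction \<phi> = 0" "P \<bullet> direction \<psi> = 0" for \<phi> \<psi>
  proof (rule ccontr)
    assume "\<phi> \<noteq> \<psi>"
    then have "sin (\<psi> - \<phi>) > 0"
      using that by (intro sin_gt_zero) auto
    moreover have "fst P * sin (\<psi> - \<phi>) = sin \<psi> * (P \<bullet> direction \<phi>) - sin \<phi> * (P \<bullet> direction \<psi>)"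
       "snd P * sin (\<psi> - \<phi>) = cos \<phi> * (P \<bullet> direction \<psi>) - cos \<psi> * (P \<bullet> direction \<phi>)"
      by (simp_all add: direction_def inner_prod_def sin_diff algebra_simps)
    ultimately have "fst P = 0" "snd P = 0"
      using that by auto
    with assms show False by (simp add: prod_eq_iff)
  qed
  then have "\<phi> = \<psi>" if "\<phi> \<in> {\<phi>\<in>{0..<pi}. P \<bullet> direction \<phi> = 0}" "\<psi> \<in> {\<phi>\<in>{0..<pi}. P \<bullet> direction \<phi> = 0}" for \<phi> \<psi>
    using that by (cases "\<phi> \<le> \<psi>") (force, metis (mono_tags, lifting) atLeastLessThan_iff linear mem_Collect_eq)
  then show ?thesis
    by (metis (no_types, lifting) finite.simps is_singletonI' is_singleton_def)
qed

text \<open>Each line through \<open>P\<close> has two opposite unit normals, and exactly one of them has a positive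
  product with \<open>P\<close> unless the line passes through the origin. So selecting the normal angles with
  \<open>0 < P \<bullet> direction \<phi>\<close> from a full turn picks one representative from almost every class
  modulo \<open>\<pi>\<close>.\<close>

lemma nn_integral_half_circle:
  fixes g :: "real \<Rightarrow> ennreal"
  assumes [measurable]: "g \<in> borel_measurable borel"
    and per: "\<And>x. g (x + pi) = g x" and P: "P \<noteq> 0"
  shows "(\<integral>\<^sup>+\<phi>\<in>{\<phi>. 0 \<le> \<phi> \<and> \<phi> < 2 * pi \<and> 0 < P \<bullet> direction \<phi>}. g \<phi> \<partial>lborel)
    = (\<integral>\<^sup>+\<phi>\<in>{a..<a + pi}. g \<phi> \<partial>lborel)"
proof -
  let ?h = "\<lambda>\<phi>. g \<phi> * indicator {\<phi>. 0 < P \<bullet> direction \<phi>} \<phi>"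
  have [measurable]: "?h \<in> borel_measurable borel" by measurable
  have "(\<integral>\<^sup>+\<phi>\<in>{\<phi>. 0 \<le> \<phi> \<and> \<phi> < 2 * pi \<and> 0 < P \<bullet> direction \<phi>}. g \<phi> \<partial>lborel)
      = (\<integral>\<^sup>+\<phi>\<in>{0..<2 * pi}. ?h \<phi> \<partial>lborel)"
    by (auto intro!: nn_integral_cong split: split_indicator)
  also have "\<dots> = (\<integral>\<^sup>+\<phi>\<in>{0..<pi}. ?h \<phi> \<partial>lborel) + (\<integral>\<^sup>+\<phi>\<in>{0..<pi}. ?h (\<phi> + pi) \<partial>lborel)"
    using nn_integral_shift_interval[of ?h 0 pi pi]
    by (subst nn_integral_split_interval[of _ 0 pi "2 * pi"]) (simp_all)
  also have "\<dots> = (\<integral>\<^sup>+\<phi>. ?h \<phi> * indicator {0..<pi} \<phi> + ?h (\<phi> + pi) * indicator {0..<pi} \<phi> \<partial>lborel)"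
    by (rule nn_integral_add[symmetric]) measurable
  also have "\<dots> = (\<integral>\<^sup>+\<phi>\<in>{0..<pi}. g \<phi> \<partial>lborel)"
  proof (rule nn_integral_cong_AE)
    have "AE \<phi> in lborel. \<phi> \<notin> {\<phi>\<in>{0..<pi}. P \<bullet> direction \<phi> = 0}"
      using finite_normals_through[OF P]
      by (intro AE_not_in finite_imp_null_set_lborel)
    then show "AE \<phi> in lborel. ?h \<phi> * indicator {0..<pi} \<phi> + ?h (\<phi> + pi) * indicator {0..<pi} \<phi>
        = g \<phi> * indicator {0..<pi} \<phi>"
      by eventually_elim (auto simp: per direction_shift_pi split: split_indicator)
  qed
  also have "\<dots> = (\<integral>\<^sup>+\<phi>\<in>{a..<a + pi}. g \<phi> \<partial>lborel)"
    using nn_integral_over_period[of g pi 0 a] per by simp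
  finally show ?thesis .
qed

text \<open>Both antiderivatives are explicit: \<open>G\<close> integrates \<open>sin\<^sup>2\<close> and \<open>H\<close> integrates the result
  of the inner integration.\<close>

lemma nn_integral_sin_squared_square:
  assumes "0 \<le> \<omega>"
  shows "(\<integral>\<^sup>+\<phi>\<in>{a..a + \<omega>}. (\<integral>\<^sup>+\<psi>\<in>{a..a + \<omega>}. ennreal ((sin (\<psi> - \<phi>))\<^sup>2) \<partial>lborel) \<partial>lborel)
    = ennreal ((\<omega>\<^sup>2 - (sin \<omega>)\<^sup>2) / 2)"
proof -
  define G where "G = (\<lambda>x. x / 2 - sin (2 * x) / 4 :: real)"
  have G: "(G has_real_derivative (sin x)\<^sup>2) (at x)" for x
  proof -
    have "(G has_real_derivative (1 / 2 - cos (2 * x) / 2)) (at x)"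
      unfolding G_def by (auto intro!: derivative_eq_intros)
    also have "1 / 2 - cos (2 * x) / 2 = (sin x)\<^sup>2"
      unfolding cos_double_sin by (simp add: field_simps)
    finally show ?thesis .
  qed
  have mono: "G x \<le> G y" if "x \<le> y" for x y
    by (rule DERIV_nonneg_imp_nondecreasing[OF that]) (metis G zero_le_power2)
  have inner: "(\<integral>\<^sup>+\<psi>\<in>{a..a + \<omega>}. ennreal ((sin (\<psi> - \<phi>))\<^sup>2) \<partial>lborel)
      = ennreal (G (a + \<omega> - \<phi>) - G (a - \<phi>))" for \<phi>
  proof (rule nn_integral_FTC_Icc)
    fix \<psi>
    have "((\<lambda>\<psi>. \<psi> - \<phi>) has_real_derivative 1) (at \<psi>)"
      by (rule derivative_eq_intros refl | simp)+
    from DERIV_chain2[OF G this]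
    show "((\<lambda>\<psi>. G (\<psi> - \<phi>)) has_real_derivative (sin (\<psi> - \<phi>))\<^sup>2) (at \<psi>)"
      by simp
  qed (use assms in simp_all)
  define H where "H = (\<lambda>\<phi>. \<omega> / 2 * \<phi> + (cos (2 * (a - \<phi>)) - cos (2 * (a + \<omega> - \<phi>))) / 8)"
  have H: "(H has_real_derivative (G (a + \<omega> - \<phi>) - G (a - \<phi>))) (at \<phi>)" for \<phi>
  proof -
    have "(H has_real_derivative
        (\<omega> / 2 + (sin (2 * (a - \<phi>)) * 2 - sin (2 * (a + \<omega> - \<phi>)) * 2) / 8)) (at \<phi>)"
      unfolding H_def by (auto intro!: derivative_eq_intros)
    also have "\<omega> / 2 + (sin (2 * (a - \<phi>)) * 2 - sin (2 * (a + \<omega> - \<phi>)) * 2) / 8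
        = G (a + \<omega> - \<phi>) - G (a - \<phi>)"
      unfolding G_def by (simp add: diff_divide_distrib add_divide_distrib)
    finally show ?thesis .
  qed
  have "(\<integral>\<^sup>+\<phi>\<in>{a..a + \<omega>}. ennreal (G (a + \<omega> - \<phi>) - G (a - \<phi>)) \<partial>lborel)
      = ennreal (H (a + \<omega>) - H a)"
  proof (rule nn_integral_FTC_Icc)
    show "(\<lambda>\<phi>. G (a + \<omega> - \<phi>) - G (a - \<phi>)) \<in> borel_measurable borel"
      unfolding G_def by measurable
    show "(H has_real_derivative G (a + \<omega> - \<phi>) - G (a - \<phi>)) (at \<phi>)" for \<phi>
      by (rule H)
    show "0 \<le> G (a + \<omega> - \<phi>) - G (a - \<phi>)" for \<phi>
      using mono[of "a - \<phi>" "a + \<omega> - \<phi>"] assms by simp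
  qed (use assms in simp)
  also have "H (a + \<omega>) - H a = \<omega>\<^sup>2 / 2 + (cos (2 * \<omega>) - 1) / 4"
    by (simp add: H_def power2_eq_square algebra_simps diff_divide_distrib add_divide_distrib)
  also have "\<dots> = (\<omega>\<^sup>2 - (sin \<omega>)\<^sup>2) / 2"
    unfolding cos_double_sin by (simp add: field_simps)
  finally show ?thesis
    unfolding inner .
qed

text \<open>The weight \<open>sin\<^sup>2 (\<psi> - \<phi>)\<close> is \<open>\<pi>\<close>-periodic in both variables, so both integrations can be
  folded from \<open>A\<close> onto one period of \<open>B\<close>, where \<open>B\<close> is an interval. When
  \<open>\<omega> = \<pi>\<close> this interval exceeds the half-open period by its right end point, a null set.\<close>

lemma nn_integral_sin_squared_periodic:
  fixes B :: "real set"
  assumes [measurable]: "B \<in> sets borel" and per: "\<And>\<phi>. \<phi> + pi \<in> B \<longleftrightarrow> \<phi> \<in> B"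
    and B: "B \<inter> {a..<a + pi} = {a..a + \<omega>} \<inter> {a..<a + pi}" and \<omega>: "0 \<le> \<omega>" "\<omega> \<le> pi"
    and P: "P \<noteq> 0"
    and A: "A = {\<phi>\<in>B. 0 \<le> \<phi> \<and> \<phi> < 2 * pi \<and> 0 < P \<bullet> direction \<phi>}"
  shows "(\<integral>\<^sup>+\<phi>\<in>A. (\<integral>\<^sup>+\<psi>\<in>A. ennreal ((sin (\<psi> - \<phi>))\<^sup>2) \<partial>lborel) \<partial>lborel)
    = ennreal ((\<omega>\<^sup>2 - (sin \<omega>)\<^sup>2) / 2)"
proof -
  have fold: "(\<integral>\<^sup>+\<phi>\<in>A. g \<phi> \<partial>lborel) = (\<integral>\<^sup>+\<phi>\<in>{a..a + \<omega>}. g \<phi> \<partial>lborel)"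
    if [measurable]: "g \<in> borel_measurable borel" and g: "\<And>x. g (x + pi) = g x" for g :: "real \<Rightarrow> ennreal"
  proof -
    have "(\<integral>\<^sup>+\<phi>\<in>A. g \<phi> \<partial>lborel)
      = (\<integral>\<^sup>+\<phi>\<in>{\<phi>. 0 \<le> \<phi> \<and> \<phi> < 2 * pi \<and> 0 < P \<bullet> direction \<phi>}. g \<phi> * indicator B \<phi> \<partial>lborel)"
      by (auto simp: A intro!: nn_integral_cong split: split_indicator)
    also have "\<dots> = (\<integral>\<^sup>+\<phi>\<in>{a..<a + pi}. g \<phi> * indicator B \<phi> \<partial>lborel)"
      using P by (intro nn_integral_half_circle) (auto simp: g per split: split_indicator)
    also have "\<dots> = (\<integral>\<^sup>+\<phi>\<in>{a..a + \<omega>}. g \<phi> \<partial>lborel)"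
    proof (rule nn_integral_cong_AE)
      have "AE \<phi> in lborel. \<phi> \<noteq> a + pi"
        by (rule AE_lborel_singleton)
      then show "AE \<phi> in lborel. g \<phi> * indicator B \<phi> * indicator {a..<a + pi} \<phi>
          = g \<phi> * indicator {a..a + \<omega>} \<phi>"
      proof eventually_elim
        case (elim \<phi>)
        show ?case
        proof (cases "\<phi> \<in> {a..<a + pi}")
          case True
          then have "\<phi> \<in> B \<longleftrightarrow> \<phi> \<in> {a..a + \<omega>}"
            using B by blast
          with True show ?thesis by (simp add: indicator_def)
        next
          case False
          with elim \<omega> have "\<phi> \<notin> {a..a + \<omega>}" by auto
          with False show ?thesis by simp
        qed
      qed
    qed
    finally show ?thesis .
  qed
  have sin: "sin (x + pi - y) = - sin (x - y)" "sin (x - (y + pi)) = - sin (x - y)" for x y :: real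
    by (simp_all add: sin_diff)
  have "(\<integral>\<^sup>+\<psi>\<in>A. ennreal ((sin (\<psi> - \<phi>))\<^sup>2) \<partial>lborel)
      = (\<integral>\<^sup>+\<psi>\<in>{a..a + \<omega>}. ennreal ((sin (\<psi> - \<phi>))\<^sup>2) \<partial>lborel)" for \<phi>
    by (rule fold) (simp_all add: sin)
  moreover have "(\<integral>\<^sup>+\<phi>\<in>A. (\<integral>\<^sup>+\<psi>\<in>{a..a + \<omega>}. ennreal ((sin (\<psi> - \<phi>))\<^sup>2) \<partial>lborel) \<partial>lborel)
      = (\<integral>\<^sup>+\<phi>\<in>{a..a + \<omega>}. (\<integral>\<^sup>+\<psi>\<in>{a..a + \<omega>}. ennreal ((sin (\<psi> - \<phi>))\<^sup>2) \<partial>lborel) \<partial>lborel)"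
    by (rule fold) (simp_all add: sin)
  ultimately show ?thesis
    using nn_integral_sin_squared_square[OF \<omega>(1)] by simp
qed

(* START *)
section \<open>The visual angle and the normals of the lines through a point\<close>

text \<open>The normal angles of the lines through \<open>P\<close> that meet \<open>K\<close>. They range over all reals, so that the
  set is \<open>\<pi>\<close>-periodic.\<close>

definition normals :: "plane set \<Rightarrow> plane \<Rightarrow> real set" where
  "normals K P = {\<phi>. \<exists>x\<in>K. (x - P) \<bullet> direction \<phi> = 0}"

lemma closed_normals:
  assumes "compact K"
  shows "closed (normals K P)"
proof -
  have "closed {z :: plane \<times> real. (fst z - P) \<bullet> direction (snd z) = 0}"
    by (intro closed_Collect_eq continuous_intros)
  from closed_compact_projection[OF assms this] show ?thesis
    by (simp add: normals_def Bex_def)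
qed

lemma normals_shift_pi: "\<phi> + pi \<in> normals K P \<longleftrightarrow> \<phi> \<in> normals K P"
  by (simp add: normals_def direction_shift_pi)

lemma normals_of_member: "P \<in> K \<Longrightarrow> normals K P = UNIV"
  by (force simp: normals_def)

text \<open>The condition on a sector inside the definition of the visual angle, with its starting angle
  made explicit.\<close>

definition spans_angle :: "plane set \<Rightarrow> plane \<Rightarrow> real \<Rightarrow> real \<Rightarrow> bool" where
  "spans_angle K P \<alpha> \<omega> \<longleftrightarrow> 0 < \<omega> \<and> \<omega> < pi \<and>
     K \<subseteq> sector P \<alpha> \<omega> \<and> ray P \<alpha> \<inter> K \<noteq> {} \<and> ray P (\<alpha> + \<omega>) \<inter> K \<noteq> {}"

lemma visual_angle_spans: "visual_angle K P = (THE \<omega>. \<exists>\<alpha>. spans_angle K P \<alpha> \<omega>)"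
  by (simp add: visual_angle_def spans_angle_def)

text \<open>A line through \<open>P\<close> with direction \<open>\<theta>\<close> in \<open>[\<alpha>, \<alpha> + \<omega>]\<close> weakly separates the points of contact
  of the two bounding rays, so it meets the connected set \<open>K\<close>. For \<open>\<theta>\<close> strictly between
  \<open>\<alpha> + \<omega>\<close> and \<open>\<alpha> + \<pi>\<close> the line meets the sector only in its vertex \<open>P\<close>. The shift by \<open>\<pi> / 2\<close>
  turns directions into normals.\<close>

lemma normals_of_spanned_angle:
  assumes "convex K" "P \<notin> K" and span: "spans_angle K P \<alpha> \<omega>"
  defines "a \<equiv> \<alpha> - pi / 2"
  shows "normals K P \<inter> {a..<a + pi} = {a..a + \<omega>} \<inter> {a..<a + pi}"
proof -
  have \<omega>: "0 < \<omega>" "\<omega> < pi" and K: "K \<subseteq> sector P \<alpha> \<omega>"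
    using span by (auto simp: spans_angle_def)
  obtain r s where r: "0 \<le> r" "P + r *\<^sub>R direction \<alpha> \<in> K"
    and s: "0 \<le> s" "P + s *\<^sub>R direction (\<alpha> + \<omega>) \<in> K"
    using span by (auto simp: spans_angle_def ray_def)
  have "\<phi> \<in> normals K P" if \<phi>: "a \<le> \<phi>" "\<phi> \<le> a + \<omega>" for \<phi>
  proof -
    let ?g = "\<lambda>x. (x - P) \<bullet> direction \<phi>"
    have "cos (\<alpha> - \<phi>) = sin (\<phi> - a)"
      by (simp add: a_def sin_cos_eq)
    moreover have "cos (\<alpha> + \<omega> - \<phi>) = - sin (a + \<omega> - \<phi>)"
      by (simp add: a_def minus_sin_cos_eq algebra_simps)
    moreover have "0 \<le> sin (\<phi> - a)" "0 \<le> sin (a + \<omega> - \<phi>)"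
      using \<phi> \<omega> by (auto intro!: sin_ge_zero)
    ultimately have ends: "?g (P + s *\<^sub>R direction (\<alpha> + \<omega>)) \<le> 0" "0 \<le> ?g (P + r *\<^sub>R direction \<alpha>)"
      using r(1) s(1) by (simp_all add: inner_direction_direction mult_nonneg_nonpos)
    \<comment> \<open>The intermediate value theorem on \<open>K\<close>, between the two points of contact.\<close>
    have "connected (?g ` K)"
      using \<open>convex K\<close> by (intro connected_continuous_image convex_connected continuous_intros)
    then have "0 \<in> ?g ` K"
      using ends r(2) s(2) by (meson connectedD_interval imageI)
    then show ?thesis
      by (auto simp: normals_def)
  qed
  moreover have "\<phi> \<notin> normals K P" if \<phi>: "a + \<omega> < \<phi>" "\<phi> < a + pi" for \<phi>
  proof
    assume "\<phi> \<in> normals K P"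
    then obtain x where x: "x \<in> K" "(x - P) \<bullet> direction \<phi> = 0"
      by (auto simp: normals_def)
    with K obtain \<theta> t where t: "0 \<le> t" "x = P + t *\<^sub>R direction \<theta>" and \<theta>: "\<alpha> \<le> \<theta>" "\<theta> \<le> \<alpha> + \<omega>"
      by (force simp: sector_def ray_def)
    have "cos (\<theta> - \<phi>) > 0"
      using \<phi> \<theta> \<omega> by (intro cos_gt_zero_pi) (auto simp: a_def)
    moreover have "t \<noteq> 0"
      using t x(1) \<open>P \<notin> K\<close> by auto
    ultimately show False
      using x(2) t by (simp add: inner_direction_direction)
  qed
  ultimately show ?thesis
    by (force simp: not_le[symmetric])
qed

text \<open>The set of normals does not refer to a sector, and by \<open>normals_of_spanned_angle\<close> its measure
  per period is \<open>\<omega>\<close> for every admissible sector. Hence all admissible sectors have the same angle.\<close>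

lemma visual_angle_eqI:
  assumes "compact K" "convex K" "P \<notin> K" and span: "spans_angle K P \<alpha> \<omega>"
  shows "visual_angle K P = \<omega>"
proof -
  have [measurable]: "normals K P \<in> sets borel"
    using closed_normals[OF \<open>compact K\<close>] by simp
  have meas: "emeasure lborel (normals K P \<inter> {0..<pi}) = ennreal \<omega>"
    if span: "spans_angle K P \<alpha> \<omega>" for \<alpha> \<omega>
  proof -
    define a where "a = \<alpha> - pi / 2"
    have \<omega>: "0 < \<omega>" "\<omega> < pi"
      using span by (auto simp: spans_angle_def)
    have "emeasure lborel (normals K P \<inter> {0..<pi})
        = (\<integral>\<^sup>+\<phi>\<in>{0..<0 + pi}. indicator (normals K P) \<phi> \<partial>lborel)"
      by (simp add: indicator_inter_arith[symmetric])
    also have "\<dots> = (\<integral>\<^sup>+\<phi>\<in>{a..<a + pi}. indicator (normals K P) \<phi> \<partial>lborel)"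
      by (rule nn_integral_over_period) (simp_all add: indicator_def normals_shift_pi)
    also have "\<dots> = emeasure lborel (normals K P \<inter> {a..<a + pi})"
      by (simp add: indicator_inter_arith[symmetric])
    also have "normals K P \<inter> {a..<a + pi} = {a..a + \<omega>} \<inter> {a..<a + pi}"
      unfolding a_def by (rule normals_of_spanned_angle[OF assms(2,3) span])
    also have "\<dots> = {a..a + \<omega>}"
      using \<omega> by auto
    finally show ?thesis
      using \<omega> by simp
  qed
  show ?thesis
    unfolding visual_angle_spans
  proof (rule the_equality)
    fix \<omega>' assume "\<exists>\<alpha>. spans_angle K P \<alpha> \<omega>'"
    then obtain \<alpha>' where "spans_angle K P \<alpha>' \<omega>'" ..
    then have "ennreal \<omega>' = ennreal \<omega>" "0 < \<omega>'" "0 < \<omega>"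
      using meas[of \<alpha>' \<omega>'] meas[OF span] span by (simp_all add: spans_angle_def)
    then show "\<omega>' = \<omega>" by simp
  qed (use span in blast)
qed

text \<open>On an open half-plane the polar angle is a continuous function, given by the arctangent of
  the slope.\<close>

lemma polar_form_in_half_plane:
  assumes "0 < v \<bullet> direction \<beta>"
  obtains r where "0 \<le> r"
    "v = r *\<^sub>R direction (\<beta> + arctan ((v \<bullet> direction (\<beta> + pi / 2)) / (v \<bullet> direction \<beta>)))"
proof -
  define c d where "c = v \<bullet> direction \<beta>" and "d = v \<bullet> direction (\<beta> + pi / 2)"
  define t where "t = arctan (d / c)"
  have c: "0 < c"
    using assms by (simp add: c_def)
  have cos: "0 < cos t"
    using arctan_bounded by (simp add: t_def cos_gt_zero_pi)
  have sin: "c * sin t = d * cos t"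
  proof -
    have "sin t / cos t = d / c"
      using tan_arctan[of "d / c"] by (simp add: t_def tan_def)
    then show ?thesis
      using c cos by (simp add: field_simps)
  qed
  have v: "fst v = c * cos \<beta> - d * sin \<beta>" "snd v = c * sin \<beta> + d * cos \<beta>"
  proof -
    have sq: "(sin \<beta>)\<^sup>2 = 1 - (cos \<beta>)\<^sup>2"
      by (rule sin_squared_eq)
    show "fst v = c * cos \<beta> - d * sin \<beta>" "snd v = c * sin \<beta> + d * cos \<beta>"
      using sq unfolding c_def d_def inner_direction_coords
      by (simp_all add: cos_add sin_add) (algebra+)
  qed
  have "v = (c / cos t) *\<^sub>R direction (\<beta> + t)"
    using cos c sin v
    by (simp add: prod_eq_iff direction_def cos_add sin_add field_simps) (algebra)
  then show ?thesis
    using that[of "c / cos t"] c cos by (simp add: t_def c_def d_def)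
qed

text \<open>A line strictly separating \<open>P\<close> from \<open>K\<close> puts \<open>K\<close>, seen from \<open>P\<close>, into an open half-plane.
  There the slope \<open>s\<close> is continuous and attains its bounds on \<open>K\<close>, which gives the two bounding rays. The
  angle is positive because a constant slope would put \<open>K\<close> into a line.\<close>

lemma spans_angle_exists:
  assumes "compact K" "convex K" "interior K \<noteq> {}" "P \<notin> K"
  obtains \<alpha> \<omega> where "spans_angle K P \<alpha> \<omega>"
proof -
  have "K \<noteq> {}"
    using assms(3) interior_subset by auto
  obtain b c where bc: "b \<bullet> P < c" "\<forall>x\<in>K. c < b \<bullet> x"
    using separating_hyperplane_closed_point[OF \<open>convex K\<close> compact_imp_closed[OF \<open>compact K\<close>] \<open>P \<notin> K\<close>]
    by auto
  then have "b \<noteq> 0"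
    using \<open>K \<noteq> {}\<close> by fastforce
  obtain \<beta> where \<beta>: "b /\<^sub>R norm b = direction \<beta>"
    using unit_vector_direction[of "b /\<^sub>R norm b"] \<open>b \<noteq> 0\<close> by auto
  have pos: "0 < (x - P) \<bullet> direction \<beta>" if "x \<in> K" for x
  proof -
    have "0 < (x - P) \<bullet> b"
      using bc(1) bspec[OF bc(2) that] by (simp add: inner_commute[of _ b] inner_diff_right)
    then show ?thesis
      using \<open>b \<noteq> 0\<close> unfolding \<beta>[symmetric] by (simp add: zero_less_mult_iff)
  qed
  define s where "s x = ((x - P) \<bullet> direction (\<beta> + pi / 2)) / ((x - P) \<bullet> direction \<beta>)" for x
  have polar: "\<exists>r\<ge>0. x = P + r *\<^sub>R direction (\<beta> + arctan (s x))" if "x \<in> K" for x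
    using polar_form_in_half_plane[OF pos[OF that]] by (metis s_def add_diff_cancel_left' diff_add_cancel add.commute)
  have "continuous_on K s"
    unfolding s_def using pos by (intro continuous_intros) force+
  obtain x1 x2 where x1: "x1 \<in> K" "\<And>x. x \<in> K \<Longrightarrow> s x1 \<le> s x"
    and x2: "x2 \<in> K" "\<And>x. x \<in> K \<Longrightarrow> s x \<le> s x2"
    using continuous_attains_inf[OF \<open>compact K\<close> \<open>K \<noteq> {}\<close> \<open>continuous_on K s\<close>]
      continuous_attains_sup[OF \<open>compact K\<close> \<open>K \<noteq> {}\<close> \<open>continuous_on K s\<close>] by blast
  have "s x1 \<noteq> s x2"
  proof
    assume eq: "s x1 = s x2"
    define n where "n = direction (\<beta> + pi / 2) - s x1 *\<^sub>R direction \<beta>"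
    have "n \<bullet> x = n \<bullet> P" if "x \<in> K" for x
    proof -
      have "s x = s x1"
        using x1(2)[OF that] x2(2)[OF that] eq by simp
      moreover have "(x - P) \<bullet> direction (\<beta> + pi / 2) = s x * ((x - P) \<bullet> direction \<beta>)"
        using pos[OF that] by (simp add: s_def)
      ultimately have "(x - P) \<bullet> n = 0"
        by (simp only: n_def inner_diff_right inner_scaleR_right)
      then show ?thesis
        by (simp add: inner_commute[of _ n] inner_diff_right)
    qed
    then have "K \<subseteq> {x. n \<bullet> x = n \<bullet> P}"
      by auto
    moreover have "n \<bullet> direction (\<beta> + pi / 2) = 1"
      by (simp add: n_def inner_diff_left inner_direction_direction)
    then have "n \<noteq> 0" by auto
    ultimately show False
      using assms(3) interior_mono interior_hyperplane by (metis subset_empty)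
  qed
  then have less: "s x1 < s x2"
    using x1(2)[OF x2(1)] by simp
  define \<alpha> \<omega> where "\<alpha> = \<beta> + arctan (s x1)" and "\<omega> = arctan (s x2) - arctan (s x1)"
  have "spans_angle K P \<alpha> \<omega>"
    unfolding spans_angle_def
  proof (intro conjI)
    show "0 < \<omega>" "\<omega> < pi"
      using less arctan_bounded[of "s x1"] arctan_bounded[of "s x2"]
      by (auto simp: \<omega>_def arctan_less_iff)
    show "ray P \<alpha> \<inter> K \<noteq> {}"
      using polar[OF x1(1)] x1(1) by (force simp: ray_def \<alpha>_def)
    show "ray P (\<alpha> + \<omega>) \<inter> K \<noteq> {}"
      using polar[OF x2(1)] x2(1) by (force simp: ray_def \<alpha>_def \<omega>_def)
    show "K \<subseteq> sector P \<alpha> \<omega>"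
    proof
      fix x assume x: "x \<in> K"
      have "\<beta> + arctan (s x) \<in> {\<alpha>..\<alpha> + \<omega>}"
        using x1(2)[OF x] x2(2)[OF x] by (simp add: \<alpha>_def \<omega>_def arctan_le_iff)
      moreover have "x \<in> ray P (\<beta> + arctan (s x))"
        using polar[OF x] by (auto simp: ray_def)
      ultimately show "x \<in> sector P \<alpha> \<omega>"
        unfolding sector_def by blast
    qed
  qed
  then show ?thesis by (rule that)
qed

section \<open>The set of lines meeting a compact set\<close>

lemma point_line_in_lines_meeting:
  "(P \<bullet> direction \<phi>, \<phi>) \<in> lines_meeting K
    \<longleftrightarrow> \<phi> \<in> normals K P \<and> 0 \<le> \<phi> \<and> \<phi> < 2 * pi \<and> 0 < P \<bullet> direction \<phi>"
proof -
  have "(x - (P \<bullet> direction \<phi>) *\<^sub>R direction \<phi>) \<bullet> direction \<phi> = (x - P) \<bullet> direction \<phi>" for x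
    by (simp add: inner_diff_left inner_direction_direction)
  then show ?thesis
    by (auto simp: lines_meeting_def line_def normals_def)
qed

lemma lines_meeting_borel:
  assumes "compact K"
  shows "lines_meeting K \<in> sets borel"
proof -
  have "closed {z :: plane \<times> real \<times> real.
      (fst z - fst (snd z) *\<^sub>R direction (snd (snd z))) \<bullet> direction (snd (snd z)) = 0}"
    by (intro closed_Collect_eq continuous_intros)
  from closed_compact_projection[OF assms this]
  have [measurable]: "{w. line (fst w) (snd w) \<inter> K \<noteq> {}} \<in> sets borel"
    by (simp add: line_def Int_def conj_commute)
  have "lines_meeting K = {w. 0 < fst w \<and> 0 \<le> snd w \<and> snd w < 2 * pi} \<inter> {w. line (fst w) (snd w) \<inter> K \<noteq> {}}"
    by (auto simp: lines_meeting_def)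
  also have "{w :: real \<times> real. 0 < fst w \<and> 0 \<le> snd w \<and> snd w < 2 * pi} = {0<..} \<times> {0..<2 * pi}"
    by auto
  finally show ?thesis
    by (auto intro!: sets.Int borel_Times)
qed

lemma bounded_lines_meeting:
  assumes "compact K"
  shows "bounded (lines_meeting K)"
proof -
  obtain R where R: "\<And>x. x \<in> K \<Longrightarrow> norm x \<le> R"
    using compact_imp_bounded[OF assms] by (auto simp: bounded_iff)
  have "lines_meeting K \<subseteq> cbox (0, 0) (R, 2 * pi)"
  proof
    fix w assume "w \<in> lines_meeting K"
    then obtain p \<phi> x where w: "w = (p, \<phi>)" "0 < p" "0 \<le> \<phi>" "\<phi> < 2 * pi" "x \<in> line p \<phi>" "x \<in> K"
      by (auto simp: lines_meeting_def)
    have "p = x \<bullet> direction \<phi>"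
      using w by (simp add: line_def inner_diff_left inner_direction_direction)
    also have "\<dots> \<le> norm x * norm (direction \<phi>)"
      by (rule norm_cauchy_schwarz)
    also have "\<dots> \<le> R"
      using R w by (simp add: norm_eq_sqrt_inner[of "direction \<phi>"] inner_direction_direction)
    finally show "w \<in> cbox (0, 0) (R, 2 * pi)"
      using w by (simp add: cbox_Pair_eq)
  qed
  then show ?thesis
    using bounded_cbox bounded_subset by blast
qed

section \<open>Integration over the intersection point\<close>

text \<open>The density at \<open>P\<close> of the intersection points of pairs of lines that meet \<open>K\<close>, each pair
  weighted with \<open>\<bar>sin (\<psi> - \<phi>)\<bar>\<close>. One factor \<open>\<bar>sin (\<psi> - \<phi>)\<bar>\<close> is this weight, the other is the Jacobian of
  the change of coordinates.\<close>

definition meeting_density :: "plane set \<Rightarrow> plane \<Rightarrow> ennreal" where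
  "meeting_density K P = (\<integral>\<^sup>+\<phi>. \<integral>\<^sup>+\<psi>. ennreal ((sin (\<psi> - \<phi>))\<^sup>2)
     * indicator (lines_meeting K \<times> lines_meeting K)
         ((P \<bullet> direction \<phi>, \<phi>), (P \<bullet> direction \<psi>, \<psi>)) \<partial>lborel \<partial>lborel)"

lemma measurable_meeting_density:
  assumes "compact K"
  shows "meeting_density K \<in> borel_measurable borel"
proof -
  have [measurable]: "lines_meeting K \<in> sets (borel \<Otimes>\<^sub>M borel)"
    using lines_meeting_borel[OF assms] by (simp only: borel_prod)
  have "(\<lambda>P. \<integral>\<^sup>+\<phi>. \<integral>\<^sup>+\<psi>. ennreal ((sin (\<psi> - \<phi>))\<^sup>2)
     * (indicator (lines_meeting K) (P \<bullet> direction \<phi>, \<phi>)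
       * indicator (lines_meeting K) (P \<bullet> direction \<psi>, \<psi>)) \<partial>lborel \<partial>lborel)
     \<in> borel_measurable borel"
    by measurable
  then show ?thesis
    by (simp add: meeting_density_def[abs_def] indicator_times)
qed

lemma meeting_density_eq:
  assumes "compact K" and "P \<noteq> 0"
    and nrm: "normals K P \<inter> {a..<a + pi} = {a..a + \<omega>} \<inter> {a..<a + pi}"
    and \<omega>: "0 \<le> \<omega>" "\<omega> \<le> pi"
  shows "meeting_density K P = ennreal ((\<omega>\<^sup>2 - (sin \<omega>)\<^sup>2) / 2)"
proof -
  define A where "A = {\<phi>\<in>normals K P. 0 \<le> \<phi> \<and> \<phi> < 2 * pi \<and> 0 < P \<bullet> direction \<phi>}"
  have N[measurable]: "normals K P \<in> sets borel"
    using closed_normals[OF \<open>compact K\<close>] by simp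
  have [measurable]: "A \<in> sets borel"
    unfolding A_def by measurable
  have ind: "indicator (lines_meeting K) (P \<bullet> direction \<phi>, \<phi>) = (indicator A \<phi> :: ennreal)" for \<phi>
    by (simp add: indicator_def point_line_in_lines_meeting A_def)
  have "meeting_density K P
      = (\<integral>\<^sup>+\<phi>. \<integral>\<^sup>+\<psi>. ennreal ((sin (\<psi> - \<phi>))\<^sup>2) * indicator A \<psi> * indicator A \<phi> \<partial>lborel \<partial>lborel)"
    by (simp add: meeting_density_def indicator_times ind ac_simps)
  also have "\<dots> = (\<integral>\<^sup>+\<phi>\<in>A. (\<integral>\<^sup>+\<psi>\<in>A. ennreal ((sin (\<psi> - \<phi>))\<^sup>2) \<partial>lborel) \<partial>lborel)"
    by (intro nn_integral_cong nn_integral_multc) measurable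
  also have "\<dots> = ennreal ((\<omega>\<^sup>2 - (sin \<omega>)\<^sup>2) / 2)"
    using N normals_shift_pi nrm \<omega> \<open>P \<noteq> 0\<close> A_def by (rule nn_integral_sin_squared_periodic)
  finally show ?thesis .
qed

text \<open>All lines through a point of \<open>K\<close> meet \<open>K\<close>, which corresponds to the angle \<open>\<pi>\<close>. The origin is
  excluded, since all lines through it lack coordinates.\<close>

lemma meeting_density_inside:
  assumes "compact K" "P \<in> K" "P \<noteq> 0"
  shows "meeting_density K P = ennreal (pi\<^sup>2 / 2)"
proof -
  have "normals K P \<inter> {0..<0 + pi} = {0..0 + pi} \<inter> {0..<0 + pi}"
    using normals_of_member[OF \<open>P \<in> K\<close>] by auto
  from meeting_density_eq[OF assms(1,3) this] show ?thesis
    by simp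
qed

lemma meeting_density_outside:
  assumes "compact K" "convex K" "interior K \<noteq> {}" "P \<notin> K" "P \<noteq> 0"
  shows "meeting_density K P = ennreal (((visual_angle K P)\<^sup>2 - (sin (visual_angle K P))\<^sup>2) / 2)"
proof -
  obtain \<alpha> \<omega> where span: "spans_angle K P \<alpha> \<omega>"
    using spans_angle_exists[OF assms(1-4)] .
  then have "0 < \<omega>" "\<omega> < pi"
    by (auto simp: spans_angle_def)
  then show ?thesis
    using meeting_density_eq[OF assms(1,5) normals_of_spanned_angle[OF assms(2,4) span]]
      visual_angle_eqI[OF assms(1,2,4) span] by simp
qed

theorem proposition7:
  fixes K :: "plane set" and F :: real
  assumes "compact K" and "convex K" and "0 \<in> interior K"
    and "C2_boundary K" and "F = measure lborel K"
  shows "set_integrable lborel (lines_meeting K \<times> lines_meeting K)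
           (\<lambda>((p1, \<phi>1), (p2, \<phi>2)). \<bar>sin (\<phi>2 - \<phi>1)\<bar>)
       \<and> set_integrable lborel (- K) (\<lambda>P. (visual_angle K P)\<^sup>2 - (sin (visual_angle K P))\<^sup>2)
       \<and> 2 * set_lebesgue_integral lborel (lines_meeting K \<times> lines_meeting K)
              (\<lambda>((p1, \<phi>1), (p2, \<phi>2)). \<bar>sin (\<phi>2 - \<phi>1)\<bar>)
         = pi\<^sup>2 * F
           + set_lebesgue_integral lborel (- K)
              (\<lambda>P. (visual_angle K P)\<^sup>2 - (sin (visual_angle K P))\<^sup>2)"
proof -
  let ?LL = "lines_meeting K \<times> lines_meeting K"
  let ?s = "\<lambda>((p1 :: real, \<phi>1 :: real), (p2 :: real, \<phi>2 :: real)). \<bar>sin (\<phi>2 - \<phi>1)\<bar>"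
  define w where "w = (\<lambda>P. (visual_angle K P)\<^sup>2 - (sin (visual_angle K P))\<^sup>2)"
  have "0 \<in> K"
    using assms(3) interior_subset by auto
  have K[measurable]: "K \<in> sets borel"
    using \<open>compact K\<close> by (simp add: compact_imp_closed)
  have LL: "?LL \<in> sets borel"
    using lines_meeting_borel[OF \<open>compact K\<close>] by (intro borel_Times)
  have s: "?s \<in> borel_measurable borel"
    by (auto simp: split_beta' intro!: borel_measurable_continuous_onI continuous_intros)
  have J: "meeting_density K \<in> borel_measurable borel"
    by (rule measurable_meeting_density) fact
  have w_nonneg: "0 \<le> w P" for P
    using abs_sin_x_le_abs_x[of "visual_angle K P"] by (simp add: w_def abs_le_square_iff)
  have J_out: "meeting_density K P = ennreal (w P / 2)" if "P \<notin> K" for P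
    using meeting_density_outside[OF assms(1,2) _ that] \<open>0 \<in> K\<close> that assms(3)
    unfolding w_def by auto

  \<comment> \<open>The set of lines meeting \<open>K\<close> is bounded, and so is the integrand. The finiteness
     obtained here also yields the integrability outside \<open>K\<close>.\<close>
  have int_s: "set_integrable lborel ?LL ?s"
    unfolding set_integrable_def
  proof (rule integrableI_bounded_set_indicator)
    show "emeasure lborel ?LL < \<infinity>"
      using bounded_lines_meeting[OF \<open>compact K\<close>] by (intro emeasure_bounded_finite bounded_Times)
    show "AE z in lborel. z \<in> ?LL \<longrightarrow> norm (?s z) \<le> 1"
      by (auto simp: split_beta')
  qed (use LL s in simp_all)
  have s_J: "ennreal (set_lebesgue_integral lborel ?LL ?s) = (\<integral>\<^sup>+P. meeting_density K P \<partial>lborel)"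
  proof -
    have "ennreal (set_lebesgue_integral lborel ?LL ?s)
        = (\<integral>\<^sup>+z. ennreal (indicator ?LL z *\<^sub>R ?s z) \<partial>lborel)"
      unfolding set_lebesgue_integral_def
      by (rule nn_integral_eq_integral[symmetric])
        (use int_s in \<open>auto simp: set_integrable_def split_beta'\<close>)
    also have "\<dots> = (\<integral>\<^sup>+((p, \<phi>), (q, \<psi>)). ennreal \<bar>sin (\<psi> - \<phi>)\<bar>
        * indicator ?LL ((p, \<phi>), (q, \<psi>)) \<partial>lborel)"
      by (intro nn_integral_cong) (auto simp: indicator_def split_beta' mem_Times_iff)
    also have "\<dots> = (\<integral>\<^sup>+P. meeting_density K P \<partial>lborel)"
      unfolding meeting_density_def
      by (rule nn_integral_line_pairs_by_intersection) (use LL in simp)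
    finally show ?thesis .
  qed

  have "(\<integral>\<^sup>+P\<in>K. meeting_density K P \<partial>lborel) = (\<integral>\<^sup>+P\<in>K. ennreal (pi\<^sup>2 / 2) \<partial>lborel)"
  proof (rule nn_integral_cong_AE)
    have "AE P in lborel. P \<noteq> (0 :: plane)"
      by (rule AE_lborel_singleton)
    then show "AE P in lborel. meeting_density K P * indicator K P = ennreal (pi\<^sup>2 / 2) * indicator K P"
      by eventually_elim (auto simp: meeting_density_inside[OF \<open>compact K\<close>] split: split_indicator)
  qed
  also have "\<dots> = ennreal (pi\<^sup>2 / 2 * F)"
    using emeasure_compact_finite[OF \<open>compact K\<close>] K
    by (simp add: nn_integral_cmult_indicator assms(5) emeasure_eq_ennreal_measure
        ennreal_mult[symmetric])
  finally have J_K: "(\<integral>\<^sup>+P\<in>K. meeting_density K P \<partial>lborel) = ennreal (pi\<^sup>2 / 2 * F)" .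

  have split: "(\<integral>\<^sup>+P. meeting_density K P \<partial>lborel)
      = (\<integral>\<^sup>+P\<in>K. meeting_density K P \<partial>lborel) + (\<integral>\<^sup>+P\<in>-K. meeting_density K P \<partial>lborel)"
    using J by (subst nn_integral_add[symmetric])
      (auto intro!: nn_integral_cong split: split_indicator)
  \<comment> \<open>Outside \<open>K\<close> the density is half the integrand of the formula. In particular this shows that
     the visual angle, defined by a description, yields a measurable integrand.\<close>
  have w_ind: "ennreal (indicator (- K) P *\<^sub>R (w P / 2)) = meeting_density K P * indicator (- K) P" for P
    by (auto simp: J_out split: split_indicator)
  have meas_w: "(\<lambda>P. indicator (- K) P *\<^sub>R (w P / 2)) \<in> borel_measurable borel"
  proof -
    have "(\<lambda>P. indicator (- K) P *\<^sub>R (w P / 2)) = (\<lambda>P. enn2real (meeting_density K P * indicator (- K) P))"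
      by (simp add: w_ind[symmetric] w_nonneg)
    then show ?thesis
      using J by simp
  qed
  have int_w2: "integrable lborel (\<lambda>P. indicator (- K) P *\<^sub>R (w P / 2))"
  proof (rule integrableI_nonneg)
    have "(\<integral>\<^sup>+P\<in>-K. meeting_density K P \<partial>lborel) \<le> ennreal (set_lebesgue_integral lborel ?LL ?s)"
      unfolding s_J split by simp
    also have "\<dots> < \<infinity>" by simp
    finally show "(\<integral>\<^sup>+P. ennreal (indicator (- K) P *\<^sub>R (w P / 2)) \<partial>lborel) < \<infinity>"
      unfolding w_ind .
  qed (use meas_w w_nonneg in simp_all)
  have w_scale: "indicator (- K) P *\<^sub>R w P = 2 * (indicator (- K) P *\<^sub>R (w P / 2))" for P
    by simp
  have int_w: "set_integrable lborel (- K) w"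
    unfolding set_integrable_def w_scale using int_w2 by (intro integrable_mult_right)
  have "(\<integral>\<^sup>+P\<in>-K. meeting_density K P \<partial>lborel)
      = ennreal (\<integral>P. indicator (- K) P *\<^sub>R (w P / 2) \<partial>lborel)"
    unfolding w_ind[symmetric] using int_w2 w_nonneg by (intro nn_integral_eq_integral) auto
  also have "(\<integral>P. indicator (- K) P *\<^sub>R (w P / 2) \<partial>lborel) = set_lebesgue_integral lborel (- K) w / 2"
    unfolding set_lebesgue_integral_def w_scale by simp
  finally have J_out_int: "(\<integral>\<^sup>+P\<in>-K. meeting_density K P \<partial>lborel)
      = ennreal (set_lebesgue_integral lborel (- K) w / 2)" .

  have nonneg: "0 \<le> set_lebesgue_integral lborel ?LL ?s" "0 \<le> set_lebesgue_integral lborel (- K) w" "0 \<le> F"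
    unfolding set_lebesgue_integral_def assms(5)
    by (auto intro!: integral_nonneg_AE simp: w_nonneg split_beta')
  have "ennreal (set_lebesgue_integral lborel ?LL ?s)
      = ennreal (pi\<^sup>2 / 2 * F + set_lebesgue_integral lborel (- K) w / 2)"
    unfolding s_J split J_K J_out_int using nonneg by (intro ennreal_plus[symmetric]) auto
  then have "set_lebesgue_integral lborel ?LL ?s
      = pi\<^sup>2 / 2 * F + set_lebesgue_integral lborel (- K) w / 2"
    using nonneg by (subst (asm) ennreal_inj) auto
  then show ?thesis
    using int_s int_w by (simp add: w_def)
qed

end
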